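(* Let $K$ be a field of characteristic $p\ge 0$. Let $g,h\in K(x)$ be rational functions of degree one, each having a fixed point in $K\cup\{\infty\}$, and let $f\in K(x)\setminus K$. Then $f\circ g=h\circ f$ if and only if one of the following holds, for some $u,v,\psi\in K(x)$ with $\deg(u)=\deg(v)=1$: (1) $f=u^{-1}\circ(\delta x+\psi(x^p-x))\circ v^{-1}$, $g=v(v^{-1}(x)+1)$, and $h=u^{-1}(u(x)+\delta)$, where $\delta\in K$, and if $p=0$ then $\psi\in K$; (2) $f=u^{-1}\circ x^e\psi(x^s)\circ v^{-1}$, $g=v(\alpha v^{-1}(x))$, and $h=u^{-1}(\alpha^e u(x))$, where $e,s\in\mathbb{Z}$, $\alpha\in K^*$, and $\alpha^s=1$.
   Context: The degree of a rational function is the maximum of the degrees of its numerator and denominator in lowest terms; $\circ$ denotes functional composition, and for a degree-one rational function $u$, $u^{-1}$ denotes its compositional inverse (also a degree-one rational function). A fixed point of $g$ in $K\cup\{\infty\}$ is a point $\rho$ of the projective line over $K$ with $g(\rho)=\rho$. *)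

theory Defs
  imports "HOL-Computational_Algebra.Computational_Algebra"
begin

text \<open>
  The rational function field \<open>K(x)\<close> is \<open>'a poly fract\<close>. The library's \<open>quot_of_fract\<close>
  needs a gcd on \<open>'a poly\<close>, which is not available for an arbitrary field, so lowest terms
  are characterised directly; the denominator is made monic to obtain uniqueness.
\<close>

definition lowest_terms :: "'a::field poly fract \<Rightarrow> 'a poly \<Rightarrow> 'a poly \<Rightarrow> bool" where
  "lowest_terms f a b \<longleftrightarrow> f = Fract a b \<and> coprime a b \<and> lead_coeff b = 1"

definition rf_num :: "'a::field poly fract \<Rightarrow> 'a poly" where
  "rf_num f = fst (THE (a, b). lowest_terms f a b)"

definition rf_denom :: "'a::field poly fract \<Rightarrow> 'a poly" where
  "rf_denom f = snd (THE (a, b). lowest_terms f a b)"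

definition rf_degree :: "'a::field poly fract \<Rightarrow> nat" where
  "rf_degree f = max (degree (rf_num f)) (degree (rf_denom f))"

definition rf_const :: "'a::field \<Rightarrow> 'a poly fract" where
  "rf_const c = to_fract [:c:]"

definition rf_X :: "'a::field poly fract" where
  "rf_X = to_fract [:0, 1:]"

text \<open>
  \<open>rf_comp f g\<close> is \<open>f(g(x))\<close>, i.e. numerator and denominator of \<open>f\<close> are evaluated at \<open>g\<close>
  in the field \<open>K(x)\<close>. The denominator vanishes at \<open>g\<close> only if \<open>g\<close> is a constant that is a
  pole of \<open>f\<close>; then \<open>f(g(x))\<close> is not an element of \<open>K(x)\<close> and \<open>rf_comp f g\<close> is 0 by the
  convention for division by zero.
\<close>

definition rf_comp :: "'a::field poly fract \<Rightarrow> 'a poly fract \<Rightarrow> 'a poly fract"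
    (infixl "\<circ>\<^sub>R" 55) where
  "f \<circ>\<^sub>R g = poly (map_poly rf_const (rf_num f)) g / poly (map_poly rf_const (rf_denom f)) g"

text \<open>Only used for \<open>rf_degree u = 1\<close>, where the inverse exists and is unique.\<close>

definition rf_inv :: "'a::field poly fract \<Rightarrow> 'a poly fract" where
  "rf_inv u = (THE w. rf_degree w = 1 \<and> w \<circ>\<^sub>R u = rf_X \<and> u \<circ>\<^sub>R w = rf_X)"

datatype 'a proj_line = Pt 'a | Infty

text \<open>
  At \<open>\<infinity>\<close>, the numerator and denominator are compared through their coefficients
  at \<open>x ^ rf_degree f\<close>, at least one of which is nonzero.
\<close>

fun rf_eval :: "'a::field poly fract \<Rightarrow> 'a proj_line \<Rightarrow> 'a proj_line" where
  "rf_eval f (Pt c) =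
     (if poly (rf_denom f) c = 0 then Infty else Pt (poly (rf_num f) c / poly (rf_denom f) c))"
| "rf_eval f Infty =
     (let n = rf_degree f in
      if coeff (rf_denom f) n = 0 then Infty
      else Pt (coeff (rf_num f) n / coeff (rf_denom f) n))"

lemma bezout_poly_field:
  fixes p q :: "'a::field poly"
  assumes "coprime p q"
  obtains a b where "a * p + b * q = 1"
proof -
  define S where "S = {r. r \<noteq> 0 \<and> (\<exists>a b. r = a * p + b * q)}"
  have "p \<noteq> 0 \<or> q \<noteq> 0" using assms by auto
  then have "p \<in> S \<or> q \<in> S"
    unfolding S_def by (auto intro: exI[of _ 0] exI[of _ 1])
  then obtain r where r: "r \<in> S" and min: "\<And>t. t \<in> S \<Longrightarrow> degree r \<le> degree t"
    using exists_least_iff[of "\<lambda>n. \<exists>t\<in>S. degree t = n"] by (metis not_le)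
  obtain a b where ab: "r = a * p + b * q" using r by (auto simp: S_def)
  have r0: "r \<noteq> 0" using r by (auto simp: S_def)
  have *: "r dvd t" if t: "t = c * p + d * q" for t c d
  proof (rule ccontr)
    assume "\<not> r dvd t"
    then have nz: "t mod r \<noteq> 0" by (simp add: mod_eq_0_iff_dvd)
    have "t mod r = t - (t div r) * r"
      by (simp add: minus_div_mult_eq_mod)
    also have "\<dots> = (c - (t div r) * a) * p + (d - (t div r) * b) * q"
      unfolding ab t by (simp add: algebra_simps)
    finally have "t mod r \<in> S" using nz unfolding S_def by blast
    then show False using min degree_mod_less[OF r0, of t] nz by (meson leD)
  qed
  have "r dvd p" using *[of p 1 0] by simp
  moreover have "r dvd q" using *[of q 0 1] by simp
  ultimately have "is_unit r" using assms by (meson coprime_common_divisor)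
  then obtain k where "1 = r * k" by (auto elim: dvdE)
  then have "(k * a) * p + (k * b) * q = 1" using ab by (simp add: algebra_simps)
  then show ?thesis using that by blast
qed

lemma lowest_terms_exists: "\<exists>a b. lowest_terms (f :: 'a::field poly fract) a b"
proof -
  define P where "P n \<longleftrightarrow> (\<exists>a b. b \<noteq> 0 \<and> f = Fract a b \<and> degree b = n)" for n
  have "\<exists>n. P n" unfolding P_def by (cases f) auto
  then obtain n where "P n" and least: "\<And>m. m < n \<Longrightarrow> \<not> P m"
    using exists_least_iff[of P] by blast
  then obtain a b where b0: "b \<noteq> 0" and f: "f = Fract a b" and db: "degree b = n"
    by (auto simp: P_def)
  have cop: "coprime a b"
  proof (rule coprimeI)
    fix d assume "d dvd a" "d dvd b"
    then obtain a' b' where a': "a = d * a'" and b': "b = d * b'" by (auto elim!: dvdE)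
    have d0: "d \<noteq> 0" and b'0: "b' \<noteq> 0" using b0 b' by auto
    have "f = Fract a' b'" unfolding f a' b' using d0 b'0 by (simp add: eq_fract)
    then have "P (degree b')" unfolding P_def using b'0 by blast
    then have "degree b \<le> degree b'" using least db by (meson not_le)
    then have "degree d = 0" using d0 b'0 by (simp add: b' degree_mult_eq)
    then show "is_unit d" using d0 by (simp add: is_unit_iff_degree)
  qed
  define c where "c = inverse (lead_coeff b)"
  have c0: "c \<noteq> 0" using b0 by (simp add: c_def)
  have "f = Fract (smult c a) (smult c b)" unfolding f using b0 c0 by (simp add: eq_fract)
  moreover have "coprime (smult c a) (smult c b)"
    using cop c0 by (simp add: coprime_def dvd_smult_iff)
  moreover have "lead_coeff (smult c b) = 1" using b0 by (simp add: c_def)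
  ultimately show ?thesis unfolding lowest_terms_def by blast
qed

lemma lowest_terms_unique:
  fixes f :: "'a::field poly fract"
  assumes "lowest_terms f a b" "lowest_terms f a' b'"
  shows "a = a' \<and> b = b'"
proof -
  have b0: "b \<noteq> 0" "b' \<noteq> 0" using assms by (auto simp: lowest_terms_def)
  have eq: "a * b' = a' * b"
    using assms b0 by (simp add: lowest_terms_def eq_fract)
  have dvd: "b dvd b'" if "coprime a b" "a * b' = a' * b" for a b a' b' :: "'a poly"
  proof -
    obtain s t where "s * a + t * b = 1" using bezout_poly_field \<open>coprime a b\<close> by blast
    then have "b' = (s * a + t * b) * b'" by simp
    also have "\<dots> = b * (s * a' + t * b')" using that(2) by (simp add: algebra_simps)
    finally show ?thesis by (metis dvd_triv_left)
  qed
  have "b dvd b'" "b' dvd b"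
    using dvd[of a b b' a'] dvd[of a' b' b a] eq assms by (auto simp: lowest_terms_def)
  then obtain k where k: "b' = b * k" and "degree b' \<le> degree b"
    using b0 by (metis dvdE dvd_imp_degree_le)
  then have "degree k = 0" using b0 by (auto simp: degree_mult_eq)
  moreover have "lead_coeff k = 1"
    using assms k by (simp add: lowest_terms_def lead_coeff_mult)
  ultimately have "k = 1" by (auto elim!: degree_eq_zeroE simp: one_pCons)
  then have "b = b'" using k by simp
  then show ?thesis using eq b0 by simp
qed

lemma lowest_terms_rf_num_denom: "lowest_terms f (rf_num f) (rf_denom f)"
proof -
  obtain a b where ab: "lowest_terms f a b" using lowest_terms_exists by blast
  have "(THE (a, b). lowest_terms f a b) = (a, b)"
    by (rule the_equality) (use ab in \<open>auto dest: lowest_terms_unique[OF ab]\<close>)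
  then show ?thesis using ab by (simp add: rf_num_def rf_denom_def)
qed

end

theory Submission
  imports Defs
begin

text \<open>
  Substituting a nonconstant \<open>h\<close> is a field homomorphism of \<open>K(x)\<close>, so composition is associative
  whenever the innermost function is nonconstant. Moving the fixed point of a degree-one map to
  \<open>\<infinity>\<close> makes the map affine, hence conjugate to \<open>x + 1\<close> or to \<open>\<alpha>x\<close>; so after composing \<open>f\<close> with
  degree-one maps on both sides it remains to solve \<open>F(G(x)) = H(F(x))\<close> with \<open>G\<close> and \<open>H\<close> of
  these shapes. As lowest terms are unique, the equation splits into equations for the numerator
  and the denominator: comparing coefficients rules out the mixed cases (except \<open>H = x\<close>, a
  translation by \<open>0\<close>). If \<open>G = x + 1\<close> and \<open>H = x + \<delta>\<close>, then \<open>F - \<delta>x\<close> is invariant under \<open>x + 1\<close>; if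
  \<open>G = \<alpha>x\<close> and \<open>H = \<gamma>x\<close>, the exponents occurring in the numerator, and those in the denominator,
  are congruent modulo the order of \<open>\<alpha>\<close>.
\<close>

subsection \<open>Composition as a field homomorphism\<close>

text \<open>Euclid's lemma: multiply a Bezout identity for \<open>a\<close> and \<open>b\<close> by
  \<open>c\<close>.\<close>

lemma coprime_dvd_mult_poly:
  fixes a b c :: "'a::field poly"
  assumes "coprime a b" "b dvd a * c"
  shows "b dvd c"
proof -
  obtain s t where "s * a + t * b = 1" using bezout_poly_field assms(1) by blast
  then have "c = (s * a + t * b) * c" by simp
  also have "\<dots> = s * (a * c) + b * (t * c)" by (simp add: algebra_simps)
  finally show ?thesis using assms(2) by (metis dvd_add dvd_mult dvd_triv_left)
qed

lemma coprime_dvd_power_mult_poly: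
  fixes a b c :: "'a::field poly"
  assumes "coprime a b" "b dvd a ^ n * c"
  shows "b dvd c"
  using assms(2)
proof (induction n)
  case (Suc n)
  then have "b dvd a * (a ^ n * c)" by (simp only: power_Suc mult.assoc)
  then show ?case using coprime_dvd_mult_poly[OF assms(1)] Suc.IH by blast
qed simp

section \<open>Constants and polynomials inside the rational function field\<close>

lemma to_fract_power: "to_fract (a ^ n) = to_fract a ^ n"
  by (induction n) simp_all

lemma rf_const_0 [simp]: "rf_const 0 = 0"
  and rf_const_1 [simp]: "rf_const 1 = 1"
  and rf_const_add [simp]: "rf_const (a + b) = rf_const a + rf_const b"
  and rf_const_diff [simp]: "rf_const (a - b) = rf_const a - rf_const b"
  and rf_const_uminus [simp]: "rf_const (- a) = - rf_const a"
  and rf_const_mult [simp]: "rf_const (a * b) = rf_const a * rf_const b"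
  by (simp_all add: rf_const_def flip: to_fract_add to_fract_diff to_fract_uminus to_fract_mult one_pCons)

lemma rf_const_eq_iff [simp]: "rf_const a = rf_const b \<longleftrightarrow> a = b"
  by (simp add: rf_const_def)

lemma rf_const_eq_0_iff [simp]: "rf_const a = 0 \<longleftrightarrow> a = 0"
  using rf_const_eq_iff[of a 0] by (simp del: rf_const_eq_iff)

lemma rf_const_inverse [simp]: "rf_const (inverse a) = inverse (rf_const a)"
proof (cases "a = 0")
  case False
  then have "rf_const (inverse a) * rf_const a = 1" by (simp flip: rf_const_mult)
  then show ?thesis by (metis inverse_inverse_eq inverse_unique mult.commute)
qed simp

lemma rf_const_divide [simp]: "rf_const (a / b) = rf_const a / rf_const b"
  by (simp add: divide_inverse)

lemma rf_const_power [simp]: "rf_const (a ^ n) = rf_const a ^ n"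
  by (induction n) simp_all

lemma rf_const_power_int [simp]: "rf_const (a powi n) = rf_const a powi n"
  by (simp add: power_int_def)

lemma to_fract_linear: "to_fract [:b, a:] = rf_const a * rf_X + rf_const b"
  by (simp add: rf_const_def rf_X_def flip: to_fract_add to_fract_mult)

text \<open>The ring homomorphism from polynomials to K(x) that sends the variable to
  \<open>g\<close>. It is split off from \<open>rf_comp\<close> so that its laws hold for every
  \<open>g\<close>, with no concern for vanishing denominators.\<close>

definition rf_ev :: "'a::field poly \<Rightarrow> 'a poly fract \<Rightarrow> 'a poly fract" where
  "rf_ev q g = poly (map_poly rf_const q) g"

lemma rf_ev_0 [simp]: "rf_ev 0 g = 0"
  by (simp add: rf_ev_def)

lemma rf_ev_pCons [simp]: "rf_ev (pCons a q) g = rf_const a + g * rf_ev q g"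
  by (simp add: rf_ev_def map_poly_pCons)

lemma rf_ev_1 [simp]: "rf_ev 1 g = 1"
  by (simp add: one_pCons)

lemma rf_ev_add [simp]: "rf_ev (p + q) g = rf_ev p g + rf_ev q g"
proof (induction p arbitrary: q)
  case (pCons a p)
  obtain b q' where "q = pCons b q'" by (cases q)
  then show ?case by (simp add: pCons.IH algebra_simps)
qed simp

lemma rf_ev_smult [simp]: "rf_ev (smult a q) g = rf_const a * rf_ev q g"
  by (induction q) (simp_all add: algebra_simps)

lemma rf_ev_mult [simp]: "rf_ev (p * q) g = rf_ev p g * rf_ev q g"
  by (induction p) (simp_all add: algebra_simps)

lemma rf_ev_to_fract: "rf_ev q (to_fract r) = to_fract (q \<circ>\<^sub>p r)"
  by (induction q) (simp_all add: pcompose_pCons rf_const_def)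

text \<open>Clearing denominators in \<open>q(g) = 0\<close> shows that the denominator of \<open>g\<close> divides the leading
  coefficient of \<open>q\<close> (as in the rational root theorem), so \<open>g\<close> is a polynomial.\<close>

lemma rf_ev_nonzero:
  assumes g: "g \<notin> range rf_const" and q: "q \<noteq> 0"
  shows "rf_ev q g \<noteq> 0"
proof
  assume ev: "rf_ev q g = 0"
  define a b where "a = rf_num g" and "b = rf_denom g"
  have lt: "g = Fract a b" "coprime a b" "lead_coeff b = 1"
    using lowest_terms_rf_num_denom[of g] by (simp_all add: lowest_terms_def a_def b_def)
  have b0: "b \<noteq> 0" using lt(3) by auto
  have "\<exists>r. rf_ev q g * to_fract b ^ degree q
      = to_fract (smult (lead_coeff q) (a ^ degree q) + b * r)"
    for q :: "'a poly"
  proof (induction q rule: pCons_induct)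
    case (pCons c q)
    show ?case
    proof (cases "q = 0")
      case True
      then show ?thesis by (intro exI[of _ 0]) (simp add: rf_const_def)
    next
      case False
      from pCons.IH obtain r where r: "rf_ev q g * to_fract b ^ degree q
        = to_fract (smult (lead_coeff q) (a ^ degree q) + b * r)" by blast
      have ga: "g * to_fract b = to_fract a"
        using lt(1) b0 by (simp add: Fract_conv_to_fract)
      have "rf_ev (pCons c q) g * to_fract b ^ degree (pCons c q)
        = rf_const c * to_fract (b ^ degree q) * to_fract b
          + (g * to_fract b) * (rf_ev q g * to_fract b ^ degree q)"
        using False by (simp add: to_fract_power algebra_simps)
      also have "\<dots> = to_fract ([:c:] * b ^ degree q * b
          + a * (smult (lead_coeff q) (a ^ degree q) + b * r))"
        unfolding ga r rf_const_def by (simp only: to_fract_mult to_fract_add)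
      also have "[:c:] * b ^ degree q * b + a * (smult (lead_coeff q) (a ^ degree q) + b * r)
          = smult (lead_coeff (pCons c q)) (a ^ degree (pCons c q))
            + b * (smult c (b ^ degree q) + a * r)"
        using False by (simp add: algebra_simps)
      finally show ?thesis by blast
    qed
  qed (auto intro: exI[of _ 0])
  then obtain r where "smult (lead_coeff q) (a ^ degree q) + b * r = 0"
    using ev by (metis mult_zero_left to_fract_eq_0_iff)
  then have "smult (lead_coeff q) (a ^ degree q) = b * (- r)" by (simp add: add_eq_0_iff2)
  then have "b dvd a ^ degree q * [:lead_coeff q:]" by simp
  then have "b dvd [:lead_coeff q:]" using coprime_dvd_power_mult_poly lt(2) by blast
  then have "degree b \<le> degree [:lead_coeff q:]" using q by (intro dvd_imp_degree_le) auto
  then have "degree b = 0" by simp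
  \<comment> \<open>A monic denominator of degree 0 is 1, so \<open>g\<close> is the polynomial
    \<open>a\<close>; composing the nonzero \<open>q\<close> with \<open>a\<close> can give 0 only
    if \<open>a\<close> is constant.\<close>
  then have b1: "b = 1" using lt(3) by (auto elim!: degree_eq_zeroE simp: one_pCons)
  then have ga: "g = to_fract a" using lt(1) by (simp add: to_fract_def)
  then have "q \<circ>\<^sub>p a = 0" using ev by (simp add: rf_ev_to_fract)
  then have "degree a = 0" using q pcompose_eq_0 by blast
  then obtain c where "a = [:c:]" by (rule degree_eq_zeroE)
  then show False using g ga by (simp add: rf_const_def)
qed

text \<open>Frees composition from lowest terms. The reduced denominator divides \<open>b\<close>,
  so it does not vanish at \<open>g\<close> either, and evaluating the cross-multiplied identity at
  \<open>g\<close> compares the two quotients.\<close>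

lemma rf_comp_Fract:
  assumes "rf_ev b g \<noteq> 0"
  shows "Fract a b \<circ>\<^sub>R g = rf_ev a g / rf_ev b g"
proof -
  let ?f = "Fract a b"
  have lt: "?f = Fract (rf_num ?f) (rf_denom ?f)" "coprime (rf_num ?f) (rf_denom ?f)"
    "lead_coeff (rf_denom ?f) = 1"
    using lowest_terms_rf_num_denom[of ?f] by (simp_all add: lowest_terms_def)
  have b0: "b \<noteq> 0" using assms by auto
  have d0: "rf_denom ?f \<noteq> 0" using lt(3) by auto
  have eq: "a * rf_denom ?f = rf_num ?f * b"
    using lt(1) b0 d0 by (simp add: eq_fract)
  then have "rf_denom ?f dvd b"
    using coprime_dvd_mult_poly[OF lt(2)] by (metis dvd_triv_right)
  then obtain k where k: "b = rf_denom ?f * k" ..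
  then have nz: "rf_ev (rf_denom ?f) g \<noteq> 0" using assms by (metis mult_zero_left rf_ev_mult)
  have "rf_ev a g * rf_ev (rf_denom ?f) g = rf_ev (rf_num ?f) g * rf_ev b g"
    using eq by (simp flip: rf_ev_mult)
  then show ?thesis using nz assms
    by (simp add: rf_comp_def frac_eq_eq flip: rf_ev_def)
qed

lemma rf_comp_const [simp]: "rf_const c \<circ>\<^sub>R g = rf_const c"
  using rf_comp_Fract[of 1 g "[:c:]"] by (simp add: rf_const_def to_fract_def)

lemma rf_X_comp [simp]: "rf_X \<circ>\<^sub>R g = g"
  using rf_comp_Fract[of 1 g "[:0, 1:]"] by (simp add: rf_X_def to_fract_def)

lemma to_fract_comp: "to_fract q \<circ>\<^sub>R g = rf_ev q g"
  using rf_comp_Fract[of 1 g q] by (simp add: to_fract_def)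

section \<open>Substitution of a nonconstant function as an embedding of fields\<close>

context
  fixes h :: "'a::field poly fract"
  assumes h: "h \<notin> range rf_const"
begin

text \<open>By \<open>rf_ev_nonzero\<close> no denominator vanishes at \<open>h\<close>, so
  arbitrary representatives can be evaluated there.\<close>

lemma rf_comp_add: "(f + g) \<circ>\<^sub>R h = (f \<circ>\<^sub>R h) + (g \<circ>\<^sub>R h)"
proof -
  obtain a b where f: "f = Fract a b" "b \<noteq> 0" by (cases f)
  obtain c d where g: "g = Fract c d" "d \<noteq> 0" by (cases g)
  show ?thesis using f g
    by (simp add: rf_comp_Fract rf_ev_nonzero[OF h] add_frac_eq)
qed

lemma rf_comp_mult: "(f * g) \<circ>\<^sub>R h = (f \<circ>\<^sub>R h) * (g \<circ>\<^sub>R h)"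
proof -
  obtain a b where f: "f = Fract a b" "b \<noteq> 0" by (cases f)
  obtain c d where g: "g = Fract c d" "d \<noteq> 0" by (cases g)
  show ?thesis using f g
    by (simp add: rf_comp_Fract rf_ev_nonzero[OF h])
qed

lemma rf_comp_uminus: "(- f) \<circ>\<^sub>R h = - (f \<circ>\<^sub>R h)"
  using rf_comp_mult[of "rf_const (- 1)" f] by (simp del: rf_const_uminus) simp

lemma rf_comp_diff: "(f - g) \<circ>\<^sub>R h = (f \<circ>\<^sub>R h) - (g \<circ>\<^sub>R h)"
  using rf_comp_add[of f "- g"] by (simp add: rf_comp_uminus)

lemma rf_comp_eq_0_iff: "f \<circ>\<^sub>R h = 0 \<longleftrightarrow> f = 0"
proof
  assume "f \<circ>\<^sub>R h = 0"
  then have "(f * inverse f) \<circ>\<^sub>R h = 0" by (simp add: rf_comp_mult)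
  then show "f = 0" using rf_comp_const[of 1 h] by (cases "f = 0") auto
qed (use rf_comp_const[of 0 h] in simp)

lemma rf_comp_inject: "f \<circ>\<^sub>R h = g \<circ>\<^sub>R h \<longleftrightarrow> f = g"
  using rf_comp_eq_0_iff[of "f - g"] by (simp add: rf_comp_diff)

lemma rf_comp_inverse: "inverse f \<circ>\<^sub>R h = inverse (f \<circ>\<^sub>R h)"
proof (cases "f = 0")
  case True
  then show ?thesis using rf_comp_const[of 0 h] by simp
next
  case False
  then have "(inverse f \<circ>\<^sub>R h) * (f \<circ>\<^sub>R h) = 1"
    using rf_comp_const[of 1 h] by (simp flip: rf_comp_mult)
  then show ?thesis by (metis inverse_inverse_eq inverse_unique mult.commute)
qed

lemma rf_comp_divide: "(f / g) \<circ>\<^sub>R h = (f \<circ>\<^sub>R h) / (g \<circ>\<^sub>R h)"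
  by (simp add: divide_inverse rf_comp_mult rf_comp_inverse)

lemma rf_comp_power: "f ^ n \<circ>\<^sub>R h = (f \<circ>\<^sub>R h) ^ n"
  by (induction n) (use rf_comp_const[of 1 h] in \<open>simp_all add: rf_comp_mult\<close>)

lemma rf_comp_power_int: "f powi n \<circ>\<^sub>R h = (f \<circ>\<^sub>R h) powi n"
  by (simp add: power_int_def rf_comp_power rf_comp_inverse)

text \<open>Substituting \<open>h\<close> respects sums, products and quotients, hence commutes with
  evaluating a polynomial at \<open>g\<close>. Division by zero is preserved as well, so
  \<open>g\<close> may be a constant, even a pole of \<open>f\<close>.\<close>

lemma rf_comp_assoc: "f \<circ>\<^sub>R g \<circ>\<^sub>R h = f \<circ>\<^sub>R (g \<circ>\<^sub>R h)"
proof -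
  have "rf_ev q g \<circ>\<^sub>R h = rf_ev q (g \<circ>\<^sub>R h)" for q
    by (induction q) (use rf_comp_const[of 0 h] in \<open>simp_all add: rf_comp_add rf_comp_mult\<close>)
  then show ?thesis
    unfolding rf_comp_def[of f] by (simp add: rf_comp_divide flip: rf_ev_def)
qed

lemma rf_comp_nonconst: "f \<notin> range rf_const \<Longrightarrow> f \<circ>\<^sub>R h \<notin> range rf_const"
  using rf_comp_inject[of f "rf_const _"] by auto

lemmas rf_comp_hom = rf_comp_add rf_comp_mult rf_comp_uminus rf_comp_diff rf_comp_inverse
  rf_comp_divide rf_comp_power rf_comp_power_int

end

lemma rf_comp_1 [simp]: "1 \<circ>\<^sub>R g = 1"
  using rf_comp_const[of 1 g] by simp

lemma const_rf_comp: "f \<circ>\<^sub>R rf_const c \<in> range rf_const"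
proof -
  have "rf_ev q (rf_const c) = rf_const (poly q c)" for q
    by (induction q) simp_all
  then show ?thesis unfolding rf_comp_def by (simp flip: rf_ev_def rf_const_divide)
qed

lemma rf_comp_nonconstD:
  assumes "u \<circ>\<^sub>R F \<circ>\<^sub>R w \<notin> range rf_const"
  shows "F \<notin> range rf_const"
proof
  assume "F \<in> range rf_const"
  then obtain c where "F = rf_const c" by blast
  then have "u \<circ>\<^sub>R F \<circ>\<^sub>R w \<in> range rf_const" using const_rf_comp[of u c] by auto
  then show False using assms by blast
qed

subsection \<open>Rational functions of degree one\<close>

lemma lowest_termsD:
  assumes "lowest_terms f a b"
  shows "f = Fract a b" "coprime a b" "lead_coeff b = 1" "b \<noteq> 0" "f = to_fract a / to_fract b"
  using assms by (auto simp: lowest_terms_def Fract_conv_to_fract)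

lemma rf_num_denom_eqI:
  assumes "lowest_terms f a b"
  shows "rf_num f = a" "rf_denom f = b"
  using lowest_terms_unique[OF assms lowest_terms_rf_num_denom] by auto

lemma coprime_smult_poly:
  fixes a b :: "'a::field poly"
  assumes "coprime a b" "c \<noteq> 0" "d \<noteq> 0"
  shows "coprime (smult c a) (smult d b)"
  using assms by (simp add: coprime_def dvd_smult_iff)

lemma coprime_polyI:
  fixes a b :: "'a::field poly"
  assumes "s * a + t * b = [:k:]" "k \<noteq> 0"
  shows "coprime a b"
proof (rule coprimeI)
  fix d assume "d dvd a" "d dvd b"
  then have "d dvd [:k:]" by (metis assms(1) dvd_add dvd_mult)
  then show "is_unit d" using assms(2) by (meson dvd_trans is_unit_triv)
qed

lemma rf_degree_Fract:
  assumes "coprime a b" "b \<noteq> 0"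
  shows "rf_degree (Fract a b) = max (degree a) (degree b)"
proof -
  define c where "c = inverse (lead_coeff b)"
  have c0: "c \<noteq> 0" using assms by (simp add: c_def)
  have "lowest_terms (Fract a b) (smult c a) (smult c b)"
    using assms c0 by (simp add: lowest_terms_def coprime_smult_poly eq_fract) (simp add: c_def)
  from rf_num_denom_eqI[OF this] show ?thesis using c0 by (simp add: rf_degree_def)
qed

lemma rf_degree_const: "rf_degree (rf_const c) = 0"
  using rf_degree_Fract[of "[:c:]" 1] by (simp add: rf_const_def to_fract_def)

lemma rf_degree_1_nonconst: "rf_degree u = 1 \<Longrightarrow> u \<notin> range rf_const"
  by (auto simp: rf_degree_const)

lemma rf_X_nonconst: "rf_X \<notin> range rf_const"
  by (auto simp: rf_X_def rf_const_def)

lemma rf_linear_eq_0_iff: "rf_const a * rf_X + rf_const b = 0 \<longleftrightarrow> a = 0 \<and> b = 0"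
  by (auto simp flip: to_fract_linear)

text \<open>The combination \<open>- c * (a * x + b) + a * (c * x + d)\<close> equals the
  determinant, so numerator and denominator are coprime; the determinant also keeps \<open>a\<close>
  and \<open>c\<close> from both being 0.\<close>

lemma rf_degree_moebius:
  assumes "a * d - b * c \<noteq> (0::'a::field)"
  shows "rf_degree ((rf_const a * rf_X + rf_const b) / (rf_const c * rf_X + rf_const d)) = 1"
proof -
  have cop: "coprime [:b, a:] [:d, c:]"
  proof (cases "c = 0")
    case True
    then show ?thesis using assms by (intro coprime_polyI[of 0 _ 1 _ d]) auto
  next
    case False
    then show ?thesis using assms
      by (intro coprime_polyI[of "[:-c:]" _ "[:a:]" _ "a * d - b * c"]) (auto simp: algebra_simps)
  qed
  have "[:d, c:] \<noteq> 0" using assms by auto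
  from rf_degree_Fract[OF cop this] show ?thesis
    using assms by (auto simp: Fract_conv_to_fract to_fract_linear)
qed

text \<open>With determinant 0, one of the two polynomials would be a nonconstant divisor of the
  other, against coprimality. The reduced numerator and denominator are returned too because
  \<open>rf_eval\<close> reads their coefficients.\<close>

lemma rf_degree_1_moebius:
  fixes u :: "'a::field poly fract"
  assumes "rf_degree u = 1"
  obtains a b c d where "a * d - b * c \<noteq> 0" "rf_num u = [:b, a:]" "rf_denom u = [:d, c:]"
    "u = (rf_const a * rf_X + rf_const b) / (rf_const c * rf_X + rf_const d)"
proof -
  have lt: "lowest_terms u (rf_num u) (rf_denom u)" by (rule lowest_terms_rf_num_denom)
  have deg: "degree (rf_num u) \<le> 1" "degree (rf_denom u) \<le> 1"
    and nz: "degree (rf_num u) = 1 \<or> degree (rf_denom u) = 1"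
    using assms by (auto simp: rf_degree_def max_def split: if_splits)
  have lin: "\<exists>a b. q = [:b, a:]" if "degree q \<le> 1" for q :: "'a poly"
    using that by (intro exI[of _ "coeff q 1"] exI[of _ "coeff q 0"] poly_eqI)
      (auto simp: coeff_pCons coeff_eq_0 split: nat.split)
  obtain a b where ab: "rf_num u = [:b, a:]" using lin deg by blast
  obtain c d where cd: "rf_denom u = [:d, c:]" using lin deg by blast
  have cop: "coprime [:b, a:] [:d, c:]" using lowest_termsD(2)[OF lt] ab cd by simp
  have "a * d - b * c \<noteq> 0"
  proof
    assume det: "a * d - b * c = 0"
    show False
    proof (cases "a = 0")
      case True
      then have "c \<noteq> 0" "b = 0" using nz det ab cd by auto
      then have "[:d, c:] dvd [:b, a:]" using True by simp
      then have "is_unit [:d, c:]" using cop by (metis coprime_common_divisor dvd_refl)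
      then show False using \<open>c \<noteq> 0\<close> by (simp add: is_unit_pCons_iff)
    next
      case False
      then have "[:d, c:] = smult (c / a) [:b, a:]" using det by (simp add: field_simps)
      then have "[:b, a:] dvd [:d, c:]" by (metis dvd_refl dvd_smult)
      then have "is_unit [:b, a:]" using cop by (metis coprime_common_divisor dvd_refl)
      then show False using False by (simp add: is_unit_pCons_iff)
    qed
  qed
  moreover have "u = (rf_const a * rf_X + rf_const b) / (rf_const c * rf_X + rf_const d)"
    using lowest_termsD(5)[OF lt] ab cd by (simp add: to_fract_linear)
  ultimately show ?thesis using that ab cd by blast
qed

lemma rf_degree_linear: "a \<noteq> 0 \<Longrightarrow> rf_degree (rf_const a * rf_X + rf_const b) = 1"
  using rf_degree_moebius[of a 1 b 0] by simp

section \<open>Compositional inverses of degree-one functions\<close>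

lemma rf_comp_X [simp]: "f \<circ>\<^sub>R rf_X = f"
proof -
  have "rf_ev q rf_X = to_fract q" for q :: "'a poly"
    unfolding rf_X_def by (simp add: rf_ev_to_fract)
  then show ?thesis using lowest_termsD(5)[OF lowest_terms_rf_num_denom[of f]]
    by (simp add: rf_comp_def flip: rf_ev_def)
qed

text \<open>The inverse is given by the adjugate matrix with rows \<open>d, - b\<close> and
  \<open>- c, a\<close>. The adjugate of the adjugate is the original matrix, so a single
  computation yields both composites.\<close>

lemma rf_degree_1_inverse_exists:
  fixes u :: "'a::field poly fract"
  assumes "rf_degree u = 1"
  shows "\<exists>w. rf_degree w = 1 \<and> w \<circ>\<^sub>R u = rf_X \<and> u \<circ>\<^sub>R w = rf_X"
proof -
  obtain a b c d where det: "a * d - b * c \<noteq> 0"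
    and u: "u = (rf_const a * rf_X + rf_const b) / (rf_const c * rf_X + rf_const d)"
    using rf_degree_1_moebius[OF assms] .
  have inv: "(rf_const a * rf_X + rf_const b) / (rf_const c * rf_X + rf_const d) \<circ>\<^sub>R
      (rf_const d * rf_X + rf_const (- b)) / (rf_const (- c) * rf_X + rf_const a) = rf_X"
    (is "?u \<circ>\<^sub>R ?w = _")
    if det: "a * d - b * c \<noteq> 0" for a b c d :: 'a
  proof -
    have w: "?w \<notin> range rf_const"
      by (rule rf_degree_1_nonconst[OF rf_degree_moebius]) (use det in \<open>simp add: algebra_simps\<close>)
    have D: "rf_const (- c) * rf_X + rf_const a \<noteq> 0" (is "?D \<noteq> 0")
      using det rf_linear_eq_0_iff[of "- c" a] by auto
    have k: "rf_const (a * d - b * c) \<noteq> 0" using det by (simp del: rf_const_diff)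
    have w': "?w * ?D = rf_const d * rf_X + rf_const (- b)" using D by simp
    \<comment> \<open>Multiplied by the denominator \<open>?D\<close> of \<open>?w\<close>, the
      numerator and the denominator of the composite become the determinant times
      \<open>rf_X\<close> and the determinant.\<close>
    have N: "(rf_const a * ?w + rf_const b) * ?D = rf_const (a * d - b * c) * rf_X"
      unfolding distrib_right mult.assoc w' by (simp add: algebra_simps)
    have M: "(rf_const c * ?w + rf_const d) * ?D = rf_const (a * d - b * c)"
      unfolding distrib_right mult.assoc w' by (simp add: algebra_simps)
    have "rf_const c * ?w + rf_const d \<noteq> 0" using M k by (metis mult_zero_left)
    moreover have "rf_const a * ?w + rf_const b = rf_X * (rf_const c * ?w + rf_const d)"
      by (rule mult_right_cancel[OF D, THEN iffD1]) (subst mult.assoc, subst N, subst M, rule mult.commute)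
    ultimately have "(rf_const a * ?w + rf_const b) / (rf_const c * ?w + rf_const d) = rf_X"
      by (simp only: nonzero_divide_eq_eq simp_thms)
    then show ?thesis by (simp only: rf_comp_hom[OF w] rf_comp_const rf_X_comp)
  qed
  have "rf_degree ((rf_const d * rf_X + rf_const (- b)) / (rf_const (- c) * rf_X + rf_const a)) = 1"
    using det by (intro rf_degree_moebius) (simp add: algebra_simps)
  moreover have "d * a - (- b) * (- c) \<noteq> 0" using det by (simp add: algebra_simps)
  ultimately show ?thesis
    using inv[OF det] inv[of d a "- b" "- c"] unfolding u minus_minus by blast
qed

lemma rf_inv_unique:
  assumes "rf_degree w = 1" "u \<circ>\<^sub>R w = rf_X" "w' \<circ>\<^sub>R u = rf_X"
  shows "w' = w"
proof -
  have "w' = w' \<circ>\<^sub>R (u \<circ>\<^sub>R w)" using assms by simp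
  also have "\<dots> = w' \<circ>\<^sub>R u \<circ>\<^sub>R w" using rf_comp_assoc rf_degree_1_nonconst assms(1) by metis
  finally show ?thesis using assms(3) by simp
qed

lemma rf_inv:
  assumes "rf_degree u = 1"
  shows "rf_degree (rf_inv u) = 1" "rf_inv u \<circ>\<^sub>R u = rf_X" "u \<circ>\<^sub>R rf_inv u = rf_X"
proof -
  obtain w where w: "rf_degree w = 1 \<and> w \<circ>\<^sub>R u = rf_X \<and> u \<circ>\<^sub>R w = rf_X"
    using rf_degree_1_inverse_exists[OF assms] by blast
  have "\<exists>!w. rf_degree w = 1 \<and> w \<circ>\<^sub>R u = rf_X \<and> u \<circ>\<^sub>R w = rf_X"
    by (rule ex1I[of _ w]) (use w rf_inv_unique[of w u] in auto)
  from theI'[OF this] show "rf_degree (rf_inv u) = 1" "rf_inv u \<circ>\<^sub>R u = rf_X" "u \<circ>\<^sub>R rf_inv u = rf_X"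
    unfolding rf_inv_def by auto
qed

lemma rf_inv_rf_inv:
  assumes "rf_degree u = 1"
  shows "rf_inv (rf_inv u) = u"
proof -
  note i = rf_inv[OF assms]
  show ?thesis using rf_inv_unique[OF assms i(2)] rf_inv(2)[OF i(1)] by blast
qed

text \<open>An affine map applied on the left multiplies the determinant by
  \<open>A\<close>.\<close>

lemma rf_degree_1_linear_comp:
  fixes w :: "'a::field poly fract"
  assumes "rf_degree w = 1" "A \<noteq> 0"
  shows "rf_degree (rf_const A * w + rf_const B) = 1"
proof -
  obtain a b c d where det: "a * d - b * c \<noteq> 0"
    and w: "w = (rf_const a * rf_X + rf_const b) / (rf_const c * rf_X + rf_const d)"
    using rf_degree_1_moebius[OF assms(1)] .
  have D: "rf_const c * rf_X + rf_const d \<noteq> 0"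
    using det rf_linear_eq_0_iff[of c d] by auto
  have "rf_const A * w + rf_const B = (rf_const (A * a + B * c) * rf_X + rf_const (A * b + B * d)) /
    (rf_const c * rf_X + rf_const d)"
    unfolding w using D by (simp add: field_simps)
  moreover have "(A * a + B * c) * d - (A * b + B * d) * c = A * (a * d - b * c)"
    by (simp add: algebra_simps)
  ultimately show ?thesis using rf_degree_moebius det assms(2) by (metis mult_eq_0_iff)
qed

text \<open>In a coordinate \<open>w\<close> that sends the fixed point to infinity,
  \<open>g\<close> fixes infinity and is therefore affine.\<close>

lemma fixed_point_affine:
  fixes g :: "'a::field poly fract"
  assumes g: "rf_degree g = 1" and fixp: "rf_eval g \<rho> = \<rho>"
  obtains w A B where "rf_degree w = 1" "A \<noteq> 0" "w \<circ>\<^sub>R g = rf_const A * w + rf_const B"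
proof -
  obtain a b c d where det: "a * d - b * c \<noteq> 0"
    and nd: "rf_num g = [:b, a:]" "rf_denom g = [:d, c:]"
    and ge: "g = (rf_const a * rf_X + rf_const b) / (rf_const c * rf_X + rf_const d)"
    using rf_degree_1_moebius[OF g] .
  note gn = rf_degree_1_nonconst[OF g]
  show ?thesis
  proof (cases \<rho>)
    case Infty
    then have c: "c = 0" using fixp by (simp add: nd g Let_def split: if_splits)
    then have ad: "a \<noteq> 0" "d \<noteq> 0" using det by auto
    show ?thesis
    proof (rule that[of rf_X "a / d" "b / d"])
      show "rf_degree rf_X = 1" using rf_degree_linear[of 1 0] by simp
    qed (use ad c ge in \<open>simp_all add: add_divide_distrib\<close>)
  next
    case (Pt r)
    then have nz: "d + r * c \<noteq> 0" and fr: "b + r * a = r * (d + r * c)"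
      using fixp by (auto simp: nd field_simps split: if_splits)
    \<comment> \<open>Chosen so that \<open>g - r\<close> equals
      \<open>e * (x - r) / (c * x + d)\<close>; the determinant then factors as
      \<open>e * (d + r * c)\<close>.\<close>
    define e where "e = a - r * c"
    have bd: "b = r * d - r * e" using fr by (simp add: e_def algebra_simps)
    have det': "a * d - b * c = e * (d + r * c)" unfolding bd e_def by (simp add: algebra_simps)
    then have e0: "e \<noteq> 0" using det by auto
    \<comment> \<open>The coordinate 1/(x - r), written as a Moebius quotient so that
      \<open>rf_degree_moebius\<close> applies.\<close>
    define w where "w = (rf_const 0 * rf_X + rf_const 1) / (rf_const 1 * rf_X + rf_const (- r))"
    have w: "w = 1 / (rf_X - rf_const r)" by (simp add: w_def)
    have D: "rf_const c * rf_X + rf_const d \<noteq> 0"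
      using det rf_linear_eq_0_iff[of c d] by auto
    have X: "rf_X - rf_const r \<noteq> 0" using rf_X_nonconst by (metis eq_iff_diff_eq_0 rangeI)
    have E: "rf_const e \<noteq> 0" using e0 by simp
    have "g - rf_const r = rf_const e * (rf_X - rf_const r) / (rf_const c * rf_X + rf_const d)"
      unfolding ge using D by (simp add: divide_simps) (simp add: bd e_def algebra_simps)
    then have "w \<circ>\<^sub>R g = (rf_const c * rf_X + rf_const d) / (rf_const e * (rf_X - rf_const r))"
      by (simp add: w rf_comp_hom[OF gn])
    also have "\<dots> = rf_const ((d + r * c) / e) * w + rf_const (c / e)"
      unfolding w using X E by (simp add: divide_simps) (simp add: algebra_simps)
    finally have "w \<circ>\<^sub>R g = rf_const ((d + r * c) / e) * w + rf_const (c / e)" .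
    moreover have "rf_degree w = 1" unfolding w_def by (rule rf_degree_moebius) simp
    ultimately show ?thesis using nz e0 by (intro that[of w "(d + r * c) / e" "c / e"]) auto
  qed
qed

text \<open>Starting from \<open>A * w + B\<close>: if \<open>A = 1\<close> and \<open>B\<close> is
  nonzero, dividing \<open>w\<close> by \<open>B\<close> gives step 1; if \<open>A\<close> is not 1,
  adding \<open>B / (A - 1)\<close> to \<open>w\<close> moves the remaining fixed point to 0. The
  identity is counted as the scaling by 1.\<close>

lemma fixed_point_normal_form:
  fixes g :: "'a::field poly fract"
  assumes g: "rf_degree g = 1" and fixp: "rf_eval g \<rho> = \<rho>"
  obtains (translation) w where "rf_degree w = 1" "w \<circ>\<^sub>R g = w + 1"
    | (scaling) w \<alpha> where "rf_degree w = 1" "\<alpha> \<noteq> 0" "w \<circ>\<^sub>R g = rf_const \<alpha> * w"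
proof -
  note gn = rf_degree_1_nonconst[OF g]
  obtain w A B where w: "rf_degree w = 1" "A \<noteq> 0" "w \<circ>\<^sub>R g = rf_const A * w + rf_const B"
    using fixed_point_affine[OF g fixp] .
  consider "A = 1" "B = 0" | "A = 1" "B \<noteq> 0" | "A \<noteq> 1" by blast
  then show ?thesis
  proof cases
    case 1
    then show ?thesis using w scaling[of w 1] by simp
  next
    case 2
    have "rf_const (1 / B) * w + rf_const 0 \<circ>\<^sub>R g = rf_const (1 / B) * w + rf_const 0 + 1"
      using w 2 by (simp add: rf_comp_hom[OF gn] field_simps del: rf_const_0)
    moreover have "rf_degree (rf_const (1 / B) * w + rf_const 0) = 1"
      using w 2 by (intro rf_degree_1_linear_comp) auto
    ultimately show ?thesis using translation by blast
  next
    case 3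
    have A: "rf_const A \<noteq> 1" "rf_const A - 1 \<noteq> 0" using 3 rf_const_eq_iff[of A 1] by auto
    have "rf_const 1 * w + rf_const (B / (A - 1)) \<circ>\<^sub>R g
        = rf_const A * (rf_const 1 * w + rf_const (B / (A - 1)))"
      using w A by (simp add: rf_comp_hom[OF gn] field_simps del: rf_const_1 rf_const_divide)
        (simp add: divide_simps; simp add: algebra_simps)
    moreover have "rf_degree (rf_const 1 * w + rf_const (B / (A - 1))) = 1"
      using w by (intro rf_degree_1_linear_comp) auto
    ultimately show ?thesis using scaling w by blast
  qed
qed

section \<open>Conjugation by degree-one functions\<close>

text \<open>Both sides become \<open>u\<^sup>-\<^sup>1 \<circ> (F \<circ> G) \<circ> v\<^sup>-\<^sup>1\<close> and \<open>u\<^sup>-\<^sup>1 \<circ> (H \<circ> F) \<circ> v\<^sup>-\<^sup>1\<close>.\<close>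

lemma conjugate_commute:
  assumes u: "rf_degree u = 1" and v: "rf_degree v = 1"
    and f: "f = rf_inv u \<circ>\<^sub>R F \<circ>\<^sub>R rf_inv v" and g: "g = v \<circ>\<^sub>R (G \<circ>\<^sub>R rf_inv v)"
    and h: "h = rf_inv u \<circ>\<^sub>R (H \<circ>\<^sub>R u)"
    and f_nonconst: "f \<notin> range rf_const" and G: "G \<notin> range rf_const"
    and FG: "F \<circ>\<^sub>R G = H \<circ>\<^sub>R F"
  shows "f \<circ>\<^sub>R g = h \<circ>\<^sub>R f"
proof -
  note iu = rf_inv[OF u] and iv = rf_inv[OF v]
  note vn = rf_degree_1_nonconst[OF v] and ivn = rf_degree_1_nonconst[OF iv(1)]
  have Fn: "F \<notin> range rf_const" using rf_comp_nonconstD f_nonconst f by blast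
  note Givn = rf_comp_nonconst[OF ivn G] and Fivn = rf_comp_nonconst[OF ivn Fn]
  have gn: "g \<notin> range rf_const" unfolding g by (rule rf_comp_nonconst[OF Givn vn])
  have "f \<circ>\<^sub>R g = rf_inv u \<circ>\<^sub>R F \<circ>\<^sub>R (rf_inv v \<circ>\<^sub>R g)"
    unfolding f by (rule rf_comp_assoc[OF gn])
  also have "rf_inv v \<circ>\<^sub>R g = G \<circ>\<^sub>R rf_inv v"
    unfolding g using rf_comp_assoc[OF Givn, of "rf_inv v" v] iv(2) by simp
  also have "rf_inv u \<circ>\<^sub>R F \<circ>\<^sub>R (G \<circ>\<^sub>R rf_inv v) = rf_inv u \<circ>\<^sub>R (H \<circ>\<^sub>R F) \<circ>\<^sub>R rf_inv v"
    by (simp add: rf_comp_assoc[OF ivn, symmetric] rf_comp_assoc[OF G] FG)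
  also have "\<dots> = rf_inv u \<circ>\<^sub>R (H \<circ>\<^sub>R (F \<circ>\<^sub>R rf_inv v))"
    by (simp add: rf_comp_assoc[OF ivn])
  also have "F \<circ>\<^sub>R rf_inv v = u \<circ>\<^sub>R f"
  proof -
    have "f = rf_inv u \<circ>\<^sub>R (F \<circ>\<^sub>R rf_inv v)" unfolding f by (rule rf_comp_assoc[OF ivn])
    then show ?thesis using rf_comp_assoc[OF Fivn, of u "rf_inv u"] iu(3) by simp
  qed
  also have "rf_inv u \<circ>\<^sub>R (H \<circ>\<^sub>R (u \<circ>\<^sub>R f)) = h \<circ>\<^sub>R f"
    unfolding h by (simp add: rf_comp_assoc[OF f_nonconst])
  finally show ?thesis .
qed

text \<open>Converse of \<open>conjugate_commute\<close>. Here \<open>F\<close> is \<open>f\<close>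
  read in the coordinate \<open>w\<close> on the source and \<open>u\<close> on the target; the
  equation for \<open>F\<close> follows by cancelling \<open>w\<close> on the right. The map
  \<open>v\<close> of the classification is \<open>rf_inv w\<close>, whence the double
  inverses.\<close>

lemma conjugate_commuteD:
  assumes u: "rf_degree u = 1" and w: "rf_degree w = 1" and g: "rf_degree g = 1"
    and wg: "w \<circ>\<^sub>R g = G \<circ>\<^sub>R w" and uh: "u \<circ>\<^sub>R h = H \<circ>\<^sub>R u"
    and f: "f \<notin> range rf_const" and h: "h \<notin> range rf_const"
    and G: "G \<notin> range rf_const"
    and fg: "f \<circ>\<^sub>R g = h \<circ>\<^sub>R f"
  obtains F where "F \<notin> range rf_const" "F \<circ>\<^sub>R G = H \<circ>\<^sub>R F" "f = rf_inv u \<circ>\<^sub>R F \<circ>\<^sub>R rf_inv (rf_inv w)"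
    "g = rf_inv w \<circ>\<^sub>R (G \<circ>\<^sub>R rf_inv (rf_inv w))" "h = rf_inv u \<circ>\<^sub>R (H \<circ>\<^sub>R u)"
proof -
  note iu = rf_inv[OF u] and iw = rf_inv[OF w]
  note un = rf_degree_1_nonconst[OF u] and wn = rf_degree_1_nonconst[OF w]
    and gn = rf_degree_1_nonconst[OF g] and iwn = rf_degree_1_nonconst[OF iw(1)]
  define F where "F = u \<circ>\<^sub>R f \<circ>\<^sub>R rf_inv w"
  have Fw: "F \<circ>\<^sub>R w = u \<circ>\<^sub>R f" unfolding F_def by (simp add: rf_comp_assoc[OF wn] iw(2))
  have Fn: "F \<notin> range rf_const" unfolding F_def
    by (intro rf_comp_nonconst iwn f un)
  have "F \<circ>\<^sub>R G \<circ>\<^sub>R w = F \<circ>\<^sub>R w \<circ>\<^sub>R g"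
    by (simp add: rf_comp_assoc[OF wn] rf_comp_assoc[OF gn] wg)
  also have "\<dots> = u \<circ>\<^sub>R h \<circ>\<^sub>R f"
    unfolding Fw by (simp add: rf_comp_assoc[OF gn] rf_comp_assoc[OF f] fg)
  also have "\<dots> = H \<circ>\<^sub>R F \<circ>\<^sub>R w"
    unfolding uh by (simp add: rf_comp_assoc[OF wn] rf_comp_assoc[OF f] Fw)
  finally have "F \<circ>\<^sub>R G = H \<circ>\<^sub>R F" by (simp add: rf_comp_inject[OF wn])
  moreover have "f = rf_inv u \<circ>\<^sub>R F \<circ>\<^sub>R rf_inv (rf_inv w)"
    unfolding rf_inv_rf_inv[OF w] rf_comp_assoc[OF wn] Fw
    by (simp add: rf_comp_assoc[OF f, symmetric] iu(2))
  moreover have "g = rf_inv w \<circ>\<^sub>R (G \<circ>\<^sub>R rf_inv (rf_inv w))"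
    unfolding rf_inv_rf_inv[OF w] wg[symmetric] by (simp add: rf_comp_assoc[OF gn, symmetric] iw(2))
  moreover have "h = rf_inv u \<circ>\<^sub>R (H \<circ>\<^sub>R u)"
    unfolding uh[symmetric] by (simp add: rf_comp_assoc[OF h, symmetric] iu(2))
  ultimately show ?thesis using that Fn by blast
qed

subsection \<open>Equivariance under translations\<close>

text \<open>A Bezout identity survives substitution, so coprimality does. The leading coefficient of
  the denominator becomes \<open>\<alpha> ^ degree Q\<close>, and the inverse factor makes it monic
  again. With such explicit lowest terms, uniqueness turns equations in K(x) into polynomial
  ones.\<close>

lemma lowest_terms_linear_comp:
  fixes F :: "'a::field poly fract"
  assumes lt: "lowest_terms F P Q" and \<alpha>: "\<alpha> \<noteq> 0"
  shows "lowest_terms (F \<circ>\<^sub>R (rf_const \<alpha> * rf_X + rf_const \<beta>))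
    (smult (inverse (\<alpha> ^ degree Q)) (P \<circ>\<^sub>p [:\<beta>, \<alpha>:])) (smult (inverse (\<alpha> ^ degree Q)) (Q \<circ>\<^sub>p [:\<beta>, \<alpha>:]))"
proof -
  let ?G = "[:\<beta>, \<alpha>:]"
  note F = lowest_termsD[OF lt]
  have QG: "Q \<circ>\<^sub>p ?G \<noteq> 0" using F(4) \<alpha> by (simp add: pcompose_eq_0_iff)
  have "F \<circ>\<^sub>R to_fract ?G = to_fract (P \<circ>\<^sub>p ?G) / to_fract (Q \<circ>\<^sub>p ?G)"
    using QG by (simp add: F(1) rf_comp_Fract rf_ev_to_fract)
  also have "\<dots> = Fract (smult (inverse (\<alpha> ^ degree Q)) (P \<circ>\<^sub>p ?G)) (smult (inverse (\<alpha> ^ degree Q)) (Q \<circ>\<^sub>p ?G))"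
    using QG \<alpha> by (simp add: eq_fract flip: Fract_conv_to_fract)
  finally have eq: "F \<circ>\<^sub>R to_fract ?G = \<dots>" .
  obtain s t where "s * P + t * Q = 1" using bezout_poly_field F(2) by blast
  then have "(s \<circ>\<^sub>p ?G) * (P \<circ>\<^sub>p ?G) + (t \<circ>\<^sub>p ?G) * (Q \<circ>\<^sub>p ?G) = [:1:]"
    by (metis one_pCons pcompose_1 pcompose_add pcompose_mult)
  then have "coprime (P \<circ>\<^sub>p ?G) (Q \<circ>\<^sub>p ?G)" by (rule coprime_polyI) simp
  moreover have "lead_coeff (Q \<circ>\<^sub>p ?G) = \<alpha> ^ degree Q"
    using F(3) \<alpha> by (simp add: lead_coeff_comp)
  ultimately show ?thesis
    using eq \<alpha> by (simp add: lowest_terms_def to_fract_linear coprime_smult_poly)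
qed

lemma lowest_terms_add_const:
  fixes F :: "'a::field poly fract"
  assumes lt: "lowest_terms F P Q"
  shows "lowest_terms (F + rf_const \<delta>) (P + smult \<delta> Q) Q"
proof -
  note F = lowest_termsD[OF lt]
  obtain s t where st: "s * P + t * Q = 1" using bezout_poly_field F(2) by blast
  have "s * (P + smult \<delta> Q) + (t - smult \<delta> s) * Q = s * P + t * Q" by (simp add: algebra_simps)
  then have "coprime (P + smult \<delta> Q) Q"
    using st by (intro coprime_polyI[of s _ "t - smult \<delta> s" _ 1]) (simp_all add: one_pCons)
  moreover have "F + rf_const \<delta> = Fract (P + smult \<delta> Q) Q"
    using F by (simp add: rf_const_def to_fract_def)
  ultimately show ?thesis using F(3) by (simp add: lowest_terms_def)
qed

lemma lowest_terms_const_mult: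
  fixes F :: "'a::field poly fract"
  assumes lt: "lowest_terms F P Q" and "\<gamma> \<noteq> 0"
  shows "lowest_terms (rf_const \<gamma> * F) (smult \<gamma> P) Q"
proof -
  note F = lowest_termsD[OF lt]
  have "rf_const \<gamma> * F = Fract (smult \<gamma> P) Q"
    using F by (simp add: rf_const_def to_fract_def)
  then show ?thesis using F(2,3) assms(2) coprime_smult_poly[of P Q \<gamma> 1]
    by (simp add: lowest_terms_def)
qed

section \<open>Polynomials invariant under the unit shift\<close>

lemma pcompose_power:
  fixes q r :: "'a::comm_semiring_1 poly"
  shows "q ^ n \<circ>\<^sub>p r = (q \<circ>\<^sub>p r) ^ n"
  by (induction n) (simp_all add: pcompose_1 pcompose_mult)

text \<open>Under the bound on \<open>n\<close> the elements 0, ..., n - 1 are distinct in the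
  field, so \<open>P\<close> takes the value \<open>c\<close> at more points than its degree allows
  unless it is constant.\<close>

lemma poly_constant_on_of_nat:
  fixes P :: "'a::field poly"
  assumes "\<And>i. i < n \<Longrightarrow> poly P (of_nat i) = c" "degree P < n" "CHAR('a) = 0 \<or> n \<le> CHAR('a)"
  shows "P = [:c:]"
proof -
  have neq: "of_nat i \<noteq> (of_nat j :: 'a)" if "i < j" "j < n" for i j
  proof
    assume "of_nat i = (of_nat j :: 'a)"
    then have "of_nat (j - i) = (0 :: 'a)" using that by (simp add: of_nat_diff)
    then have "CHAR('a) dvd j - i" by (simp add: of_nat_eq_0_iff_char_dvd)
    then show False using that assms(3) by (auto dest: dvd_imp_le)
  qed
  have "inj_on (of_nat :: nat \<Rightarrow> 'a) {..<n}"
    by (rule inj_onI) (metis lessThan_iff nat_neq_iff neq)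
  then have "card ((of_nat :: nat \<Rightarrow> 'a) ` {..<n}) = n" by (simp add: card_image)
  then show ?thesis
    using assms by (intro poly_eqI_degree[of "of_nat ` {..<n}"]) auto
qed

lemma shift_invariant_poly_of_nat:
  fixes P :: "'a::field poly"
  assumes "P \<circ>\<^sub>p [:1, 1:] = P"
  shows "poly P (of_nat i) = poly P 0"
proof (induction i)
  case (Suc i)
  have "poly P (of_nat (Suc i)) = poly (P \<circ>\<^sub>p [:1, 1:]) (of_nat i)" by (simp add: poly_pcompose)
  then show ?case using Suc assms by simp
qed simp

lemma shift_invariant_poly_char_0:
  fixes P :: "'a::field poly"
  assumes "P \<circ>\<^sub>p [:1, 1:] = P" "CHAR('a) = 0"
  shows "P = [:poly P 0:]"
  using assms by (intro poly_constant_on_of_nat[of "Suc (degree P)"] shift_invariant_poly_of_nat) auto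

text \<open>The Artin-Schreier polynomial. Shift invariance is additivity of the p-th power; the
  same additivity gives Fermat's little theorem by induction on \<open>i\<close>.\<close>

lemma artin_schreier_poly:
  fixes T :: "'a::field poly"
  assumes "p = CHAR('a)" "p > 0" and T: "T = [:0, 1:] ^ p - [:0, 1:]"
  shows "degree T = p" "T \<circ>\<^sub>p [:1, 1:] = T" "poly T (of_nat i) = 0"
proof -
  have p: "prime p" "p > 1" using assms prime_CHAR_semidom[where ?'a = 'a] prime_gt_1_nat by auto
  have "degree ([:0, 1:] ^ p :: 'a poly) = p" by (simp add: degree_power_eq)
  then show "degree T = p" unfolding T using p
    by (subst diff_conv_add_uminus, subst degree_add_eq_left) auto
  have "([:0, 1:] + 1 :: 'a poly) ^ p = [:0, 1:] ^ p + 1 ^ p"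
    by (rule freshmans_dream) (use assms p in auto)
  moreover have "[:0, 1:] + 1 = ([:1, 1:] :: 'a poly)" by (simp add: one_pCons)
  ultimately have "([:1, 1:] :: 'a poly) ^ p = [:0, 1:] ^ p + 1" by simp
  then show "T \<circ>\<^sub>p [:1, 1:] = T"
    by (simp add: T pcompose_diff pcompose_power pcompose_pCons one_pCons)
  have "of_nat i ^ p = (of_nat i :: 'a)"
  proof (induction i)
    case (Suc i)
    have "(1 + of_nat i :: 'a) ^ p = 1 ^ p + of_nat i ^ p"
      by (rule freshmans_dream) (use assms p in auto)
    then show ?case using Suc by simp
  qed (use p in simp)
  then show "poly T (of_nat i) = 0" by (simp add: T)
qed

text \<open>Dividing by \<open>x\<^sup>p - x\<close> leaves a remainder that agrees with \<open>P\<close> on the prime field, where \<open>P\<close> is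
  constant; the remainder has degree less than \<open>p\<close>, so it is constant, and the quotient is again
  shift invariant.\<close>

lemma shift_invariant_poly_char_p:
  fixes P :: "'a::field poly"
  assumes "P \<circ>\<^sub>p [:1, 1:] = P" and p: "p = CHAR('a)" "p > 0"
  shows "\<exists>A. P = A \<circ>\<^sub>p ([:0, 1:] ^ p - [:0, 1:])"
proof -
  define T :: "'a poly" where "T = [:0, 1:] ^ p - [:0, 1:]"
  note AS = artin_schreier_poly[OF p T_def]
  have T0: "T \<noteq> 0" using AS(1) p by auto
  have "\<exists>A. P = A \<circ>\<^sub>p T" using assms(1)
  proof (induction "degree P" arbitrary: P rule: less_induct)
    case less
    have PRT: "P = P div T * T + P mod T" by simp
    have "poly (P mod T) (of_nat i) = poly P 0" for i
      using shift_invariant_poly_of_nat[OF less.prems, of i] arg_cong[OF PRT, of "\<lambda>q. poly q (of_nat i)"]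
        AS(3)[of i] by (metis add_0 mult_zero_right poly_add poly_mult)
    moreover have "degree (P mod T) < p"
      using degree_mod_less[OF T0, of P] AS(1) p by auto
    ultimately have R: "P mod T = [:poly P 0:]"
      using p by (intro poly_constant_on_of_nat[of p]) auto
    show ?case
    proof (cases "P div T = 0")
      case True
      then have "P = [:poly P 0:]" using PRT R by simp
      then have "P = [:poly P 0:] \<circ>\<^sub>p T" by (subst pcompose_const)
      then show ?thesis by blast
    next
      case False
      have "(P div T) \<circ>\<^sub>p [:1, 1:] * T + [:poly P 0:] = P \<circ>\<^sub>p [:1, 1:]"
        by (subst (3) PRT) (simp add: R pcompose_add pcompose_mult AS(2))
      also have "\<dots> = P div T * T + [:poly P 0:]" using less.prems PRT R by simp
      finally have "(P div T) \<circ>\<^sub>p [:1, 1:] = P div T" using T0 by simp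
      moreover have "degree (P div T) < degree P"
      proof -
        have "degree (P div T * T) = degree (P div T) + p"
          using False T0 AS(1) by (simp add: degree_mult_eq)
        moreover have "degree P = degree (P div T * T)"
          using PRT R p \<open>degree (P div T * T) = _\<close>
          by (metis add_pos_nonneg add.commute degree_add_eq_left degree_pCons_0 le_add2 less_le_trans)
        ultimately show ?thesis using p by simp
      qed
      ultimately obtain A where A: "P div T = A \<circ>\<^sub>p T" using less.hyps by blast
      \<comment> \<open>One Horner step: \<open>P\<close> is \<open>T * A(T)\<close> plus the
        constant remainder.\<close>
      have "P = pCons (poly P 0) A \<circ>\<^sub>p T"
        using PRT unfolding R A by (simp add: pcompose_pCons mult.commute add.commute)
      then show ?thesis by blast
    qed
  qed
  then show ?thesis by (simp add: T_def)
qed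

section \<open>Rational functions and the unit shift\<close>

lemma rf_X_plus_1: "rf_X + 1 = rf_const 1 * rf_X + rf_const 1"
  by simp

lemma rf_X_plus_1_nonconst: "rf_X + 1 \<notin> range rf_const"
  unfolding rf_X_plus_1 by (rule rf_degree_1_nonconst[OF rf_degree_linear]) simp

lemma rf_scaling_nonconst: "\<alpha> \<noteq> 0 \<Longrightarrow> rf_const \<alpha> * rf_X \<notin> range rf_const"
  using rf_degree_1_nonconst[OF rf_degree_linear[of \<alpha> 0]] by simp

text \<open>For a shift the normalising factor is 1, so uniqueness of lowest terms makes numerator
  and denominator separately invariant. Both are then constant, or both polynomials in
  \<open>x ^ p - x\<close>.\<close>

lemma shift_invariant:
  fixes L :: "'a::field poly fract"
  assumes L: "L \<circ>\<^sub>R (rf_X + 1) = L" and p: "p = CHAR('a)"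
  shows "\<exists>\<psi>. L = \<psi> \<circ>\<^sub>R (rf_X ^ p - rf_X) \<and> (p = 0 \<longrightarrow> \<psi> \<in> range rf_const)"
proof -
  obtain P Q where lt: "lowest_terms L P Q" using lowest_terms_exists by blast
  note PQ = lowest_termsD[OF lt]
  have "lowest_terms L (P \<circ>\<^sub>p [:1, 1:]) (Q \<circ>\<^sub>p [:1, 1:])"
    using lowest_terms_linear_comp[OF lt, of 1 1] L by simp
  from lowest_terms_unique[OF this lt]
  have inv: "P \<circ>\<^sub>p [:1, 1:] = P" "Q \<circ>\<^sub>p [:1, 1:] = Q" by auto
  show ?thesis
  proof (cases "p = 0")
    case True
    then have "L = rf_const (poly P 0) / rf_const (poly Q 0)"
      using PQ(5) shift_invariant_poly_char_0 inv p unfolding rf_const_def by metis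
    then obtain c where "L = rf_const c" by (metis rf_const_divide)
    then show ?thesis by (intro exI[of _ "rf_const c"]) simp
  next
    case False
    obtain A B where AB: "P = A \<circ>\<^sub>p ([:0, 1:] ^ p - [:0, 1:])" "Q = B \<circ>\<^sub>p ([:0, 1:] ^ p - [:0, 1:])"
      using shift_invariant_poly_char_p[OF inv(1) p] shift_invariant_poly_char_p[OF inv(2) p] False
      by blast
    have ev: "rf_ev q (rf_X ^ p - rf_X) = to_fract (q \<circ>\<^sub>p ([:0, 1:] ^ p - [:0, 1:]))" for q :: "'a poly"
      unfolding rf_X_def by (simp only: rf_ev_to_fract flip: to_fract_power to_fract_diff)
    have "Fract A B \<circ>\<^sub>R (rf_X ^ p - rf_X) = rf_ev A (rf_X ^ p - rf_X) / rf_ev B (rf_X ^ p - rf_X)"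
      by (rule rf_comp_Fract) (use PQ(4) in \<open>simp add: ev flip: AB\<close>)
    also have "\<dots> = L" by (simp add: ev PQ(5) flip: AB)
    finally show ?thesis using False by blast
  qed
qed

text \<open>\<open>\<delta> * x\<close> is a particular solution, and two solutions differ by an
  invariant function.\<close>

lemma shift_equivariant:
  fixes F :: "'a::field poly fract"
  assumes F: "F \<circ>\<^sub>R (rf_X + 1) = F + rf_const \<delta>" and p: "p = CHAR('a)"
  obtains \<psi> where "F = rf_const \<delta> * rf_X + (\<psi> \<circ>\<^sub>R (rf_X ^ p - rf_X))" "p = 0 \<longrightarrow> \<psi> \<in> range rf_const"
proof -
  have "(F - rf_const \<delta> * rf_X) \<circ>\<^sub>R (rf_X + 1) = F - rf_const \<delta> * rf_X"
    by (simp add: rf_comp_hom[OF rf_X_plus_1_nonconst] F algebra_simps)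
  from shift_invariant[OF this p] obtain \<psi> where
    "F - rf_const \<delta> * rf_X = \<psi> \<circ>\<^sub>R (rf_X ^ p - rf_X)" "p = 0 \<longrightarrow> \<psi> \<in> range rf_const" by blast
  then show ?thesis using that[of \<psi>] by (simp add: algebra_simps)
qed

lemma artin_schreier_shift:
  fixes \<psi> :: "'a::field poly fract"
  assumes p: "p = CHAR('a)" and \<psi>: "p = 0 \<longrightarrow> \<psi> \<in> range rf_const"
  shows "(rf_const \<delta> * rf_X + (\<psi> \<circ>\<^sub>R (rf_X ^ p - rf_X))) \<circ>\<^sub>R (rf_X + 1)
    = rf_const \<delta> * rf_X + (\<psi> \<circ>\<^sub>R (rf_X ^ p - rf_X)) + rf_const \<delta>"
proof -
  have "\<psi> \<circ>\<^sub>R (rf_X ^ p - rf_X) \<circ>\<^sub>R (rf_X + 1) = \<psi> \<circ>\<^sub>R (rf_X ^ p - rf_X)"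
  proof (cases "p = 0")
    \<comment> \<open>Here \<open>x ^ p - x\<close> is \<open>1 - x\<close>, which the shift does
      not fix, so the constancy of \<open>\<psi>\<close> is what counts.\<close>
    case True
    then show ?thesis using \<psi> by auto
  next
    case False
    have X: "rf_X + 1 = to_fract [:1, 1::'a:]" by (simp add: to_fract_linear)
    have "rf_X ^ p - rf_X = to_fract ([:0, 1:] ^ p - [:0, 1::'a:])"
      by (simp add: rf_X_def to_fract_power)
    then have "(rf_X ^ p - rf_X :: 'a poly fract) \<circ>\<^sub>R (rf_X + 1) = rf_X ^ p - rf_X"
      using artin_schreier_poly(2)[OF p _ refl] False
      by (simp only: X to_fract_comp rf_ev_to_fract)
    then show ?thesis by (simp add: rf_comp_assoc[OF rf_X_plus_1_nonconst])
  qed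
  then show ?thesis
    by (simp add: rf_comp_hom[OF rf_X_plus_1_nonconst] algebra_simps)
qed

text \<open>The shift preserves the leading coefficient of the numerator, while the right-hand side
  multiplies it by \<open>\<gamma>\<close>.\<close>

lemma shift_eigenvalue:
  fixes F :: "'a::field poly fract"
  assumes F: "F \<circ>\<^sub>R (rf_X + 1) = rf_const \<gamma> * F" and "F \<noteq> 0" "\<gamma> \<noteq> 0"
  shows "\<gamma> = 1"
proof -
  obtain P Q where lt: "lowest_terms F P Q" using lowest_terms_exists by blast
  have P0: "P \<noteq> 0" using lowest_termsD(5)[OF lt] \<open>F \<noteq> 0\<close> by auto
  have "lowest_terms (rf_const \<gamma> * F) (P \<circ>\<^sub>p [:1, 1:]) (Q \<circ>\<^sub>p [:1, 1:])"
    using lowest_terms_linear_comp[OF lt, of 1 1] F by simp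
  from lowest_terms_unique[OF this lowest_terms_const_mult[OF lt \<open>\<gamma> \<noteq> 0\<close>]]
  have "P \<circ>\<^sub>p [:1, 1:] = smult \<gamma> P" by simp
  then have "lead_coeff P = lead_coeff (smult \<gamma> P)"
    using lead_coeff_comp[of "[:1, 1:]" P] by simp
  then show ?thesis using P0 \<open>\<gamma> \<noteq> 0\<close> by simp
qed

subsection \<open>Equivariance under scalings\<close>

lemma scaling_not_translation:
  fixes F :: "'a::field poly fract"
  assumes "\<alpha> \<noteq> 0"
  shows "F \<circ>\<^sub>R (rf_const \<alpha> * rf_X) \<noteq> F + 1"
proof
  assume F: "F \<circ>\<^sub>R (rf_const \<alpha> * rf_X) = F + 1"
  obtain P Q where lt: "lowest_terms F P Q" using lowest_terms_exists by blast
  have "lowest_terms (F + 1) (smult (inverse (\<alpha> ^ degree Q)) (P \<circ>\<^sub>p [:0, \<alpha>:]))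
      (smult (inverse (\<alpha> ^ degree Q)) (Q \<circ>\<^sub>p [:0, \<alpha>:]))"
    using lowest_terms_linear_comp[OF lt \<open>\<alpha> \<noteq> 0\<close>, of 0] F by simp
  moreover have "lowest_terms (F + 1) (P + Q) Q"
    using lowest_terms_add_const[OF lt, of 1] by simp
  ultimately have "smult (inverse (\<alpha> ^ degree Q)) (P \<circ>\<^sub>p [:0, \<alpha>:]) = P + Q"
    using lowest_terms_unique by blast
  \<comment> \<open>At the degree of the monic \<open>Q\<close> the scaling factors cancel on the
    left, whereas the right-hand side gains the leading coefficient 1 of \<open>Q\<close>.\<close>
  then have "coeff (smult (inverse (\<alpha> ^ degree Q)) (P \<circ>\<^sub>p [:0, \<alpha>:])) (degree Q) = coeff (P + Q) (degree Q)"
    by simp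
  then show False using \<open>\<alpha> \<noteq> 0\<close> lowest_termsD(3)[OF lt] by (simp add: coeff_pcompose_linear flip: mult.assoc)
qed

text \<open>Here \<open>s\<close> is the order of \<open>\<alpha>\<close>, with 0 for infinite
  order: since \<open>i mod 0 = i\<close>, the same formula then says that all powers are
  distinct.\<close>

lemma multiplicative_order:
  fixes \<alpha> :: "'a::field"
  assumes "\<alpha> \<noteq> 0"
  obtains s :: nat where "\<And>i j. \<alpha> ^ i = \<alpha> ^ j \<longleftrightarrow> i mod s = j mod s"
proof -
  obtain s :: nat where s: "\<And>k. \<alpha> ^ k = 1 \<longleftrightarrow> s dvd k"
  proof (cases "\<exists>k>0. \<alpha> ^ k = 1")
    case False
    then show ?thesis by (intro that[of 0]) (metis dvd_0_left_iff gr0I power_0)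
  next
    case True
    define s where "s = (LEAST k. k > 0 \<and> \<alpha> ^ k = 1)"
    have s: "s > 0" "\<alpha> ^ s = 1" using LeastI_ex[OF True] by (simp_all add: s_def)
    have mod: "\<alpha> ^ k = \<alpha> ^ (k mod s)" for k
      using s(2) by (metis div_mult_mod_eq mult_1 power_add power_mult power_one mult.commute)
    have "k mod s = 0" if "\<alpha> ^ k = 1" for k
    proof (rule ccontr)
      assume "k mod s \<noteq> 0"
      then have "s \<le> k mod s" unfolding s_def
        using mod[of k] that by (intro Least_le) (simp add: s_def)
      then show False using s(1) by (metis mod_less_divisor not_le)
    qed
    then show ?thesis using mod by (intro that[of s]) (metis dvd_eq_mod_eq_0 power_0)
  qed
  have le: "\<alpha> ^ i = \<alpha> ^ j \<longleftrightarrow> i mod s = j mod s" if "i \<le> j" for i j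
  proof -
    have "\<alpha> ^ j = \<alpha> ^ i * \<alpha> ^ (j - i)" using that by (simp flip: power_add)
    then have "\<alpha> ^ i = \<alpha> ^ j \<longleftrightarrow> \<alpha> ^ (j - i) = 1" using assms by auto
    then show ?thesis using that by (metis s mod_eq_dvd_iff_nat)
  qed
  show ?thesis by (rule that[of s]) (metis le nat_le_linear)
qed

text \<open>On the support of \<open>P\<close> each exponent is \<open>r + s * (i div s)\<close>, so
  \<open>A\<close> collects the quotients \<open>i div s\<close>. For \<open>s = 0\<close> this
  describes a monomial.\<close>

lemma poly_in_power:
  fixes P :: "'a::field poly"
  assumes "\<And>i. coeff P i \<noteq> 0 \<Longrightarrow> i mod s = r"
  shows "\<exists>A. P = [:0, 1:] ^ r * (A \<circ>\<^sub>p [:0, 1:] ^ s)"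
proof -
  define A where "A = (\<Sum>i\<le>degree P. smult (coeff P i) ([:0, 1:] ^ (i div s)))"
  have "[:0, 1:] ^ r * (A \<circ>\<^sub>p [:0, 1:] ^ s)
      = (\<Sum>i\<le>degree P. smult (coeff P i) ([:0, 1:] ^ (r + s * (i div s))))"
    by (simp add: A_def pcompose_sum pcompose_smult pcompose_power pcompose_pCons sum_distrib_left power_add power_mult)
  also have "\<dots> = (\<Sum>i\<le>degree P. monom (coeff P i) i)"
  proof (rule sum.cong[OF refl])
    fix i
    have "smult (coeff P i) ([:0, 1:] ^ (r + s * (i div s))) = smult (coeff P i) ([:0, 1:] ^ i)"
      using assms[of i] by (cases "coeff P i = 0") auto
    then show "smult (coeff P i) ([:0, 1:] ^ (r + s * (i div s))) = monom (coeff P i) i"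
      by (simp add: monom_altdef)
  qed
  also have "\<dots> = P" by (rule poly_as_sum_of_monoms)
  finally show ?thesis by metis
qed

lemma scaling_equivariant:
  fixes F :: "'a::field poly fract"
  assumes F: "F \<circ>\<^sub>R (rf_const \<alpha> * rf_X) = rf_const \<gamma> * F" and "F \<noteq> 0" "\<alpha> \<noteq> 0" "\<gamma> \<noteq> 0"
  obtains e s :: int and \<psi> where "F = rf_X powi e * (\<psi> \<circ>\<^sub>R (rf_X powi s))" "\<gamma> = \<alpha> powi e" "\<alpha> powi s = 1"
proof -
  obtain P Q where lt: "lowest_terms F P Q" using lowest_terms_exists by blast
  note PQ = lowest_termsD[OF lt]
  have P0: "P \<noteq> 0" using PQ(5) \<open>F \<noteq> 0\<close> by auto
  define n where "n = degree Q"
  have "lowest_terms (rf_const \<gamma> * F) (smult (inverse (\<alpha> ^ n)) (P \<circ>\<^sub>p [:0, \<alpha>:]))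
      (smult (inverse (\<alpha> ^ n)) (Q \<circ>\<^sub>p [:0, \<alpha>:]))"
    using lowest_terms_linear_comp[OF lt \<open>\<alpha> \<noteq> 0\<close>, of 0] F by (simp add: n_def)
  from lowest_terms_unique[OF this lowest_terms_const_mult[OF lt \<open>\<gamma> \<noteq> 0\<close>]]
  have "smult (inverse (\<alpha> ^ n)) (P \<circ>\<^sub>p [:0, \<alpha>:]) = smult \<gamma> P" "smult (inverse (\<alpha> ^ n)) (Q \<circ>\<^sub>p [:0, \<alpha>:]) = Q"
    by auto
  then have "inverse (\<alpha> ^ n) * (\<alpha> ^ i * coeff P i) = \<gamma> * coeff P i"
      "inverse (\<alpha> ^ n) * (\<alpha> ^ i * coeff Q i) = coeff Q i" for i
    by (metis coeff_pcompose_linear coeff_smult)+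
  \<comment> \<open>The support of each polynomial lies in one class of exponents with equal powers
    of \<open>\<alpha>\<close>; the classes of \<open>P\<close> and \<open>Q\<close> are represented
    by their degrees \<open>m\<close> and \<open>n\<close>, and \<open>\<gamma>\<close> is the ratio
    of the two powers.\<close>
  then have coeffs: "\<And>i. coeff P i \<noteq> 0 \<Longrightarrow> \<alpha> ^ i = \<gamma> * \<alpha> ^ n" "\<And>i. coeff Q i \<noteq> 0 \<Longrightarrow> \<alpha> ^ i = \<alpha> ^ n"
    using \<open>\<alpha> \<noteq> 0\<close> by (auto simp: field_simps)
  define m where "m = degree P"
  have m: "\<alpha> ^ m = \<gamma> * \<alpha> ^ n" using coeffs(1) P0 by (simp add: m_def)
  obtain s where s: "\<And>i j. \<alpha> ^ i = \<alpha> ^ j \<longleftrightarrow> i mod s = j mod s"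
    using multiplicative_order[OF \<open>\<alpha> \<noteq> 0\<close>] by blast
  define r r' where "r = m mod s" and "r' = n mod s"
  have "\<exists>A. P = [:0, 1:] ^ r * (A \<circ>\<^sub>p [:0, 1:] ^ s)" "\<exists>B. Q = [:0, 1:] ^ r' * (B \<circ>\<^sub>p [:0, 1:] ^ s)"
    by (rule poly_in_power; use coeffs m s in \<open>metis r_def r'_def\<close>)+
  then obtain A B where AB: "P = [:0, 1:] ^ r * (A \<circ>\<^sub>p [:0, 1:] ^ s)" "Q = [:0, 1:] ^ r' * (B \<circ>\<^sub>p [:0, 1:] ^ s)"
    by blast
  have ev: "to_fract (q \<circ>\<^sub>p [:0, 1:] ^ s) = rf_ev q (rf_X ^ s)" for q :: "'a poly"
    unfolding rf_X_def by (simp only: rf_ev_to_fract flip: to_fract_power)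
  have X0: "rf_X \<noteq> (0 :: 'a poly fract)" by (simp add: rf_X_def)
  have P: "to_fract P = rf_X ^ r * rf_ev A (rf_X ^ s)" and Q: "to_fract Q = rf_X ^ r' * rf_ev B (rf_X ^ s)"
    by (simp_all only: AB to_fract_mult to_fract_power ev rf_X_def)
  have "rf_ev B (rf_X ^ s) \<noteq> 0" using PQ(4) Q by auto
  then have "Fract A B \<circ>\<^sub>R (rf_X powi int s) = rf_ev A (rf_X ^ s) / rf_ev B (rf_X ^ s)"
    by (simp add: rf_comp_Fract)
  moreover have "rf_X powi (int r - int r') = rf_X ^ r / (rf_X ^ r' :: 'a poly fract)"
    using X0 by (simp add: power_int_diff)
  ultimately have "F = rf_X powi (int r - int r') * (Fract A B \<circ>\<^sub>R (rf_X powi int s))"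
    unfolding PQ(5) P Q by simp
  \<comment> \<open>Passing from the degrees to their residues leaves the powers of
    \<open>\<alpha>\<close> unchanged, so \<open>e = r - r'\<close> serves for both \<open>F\<close>
    and \<open>\<gamma>\<close>.\<close>
  moreover have "\<alpha> ^ r = \<alpha> ^ m" "\<alpha> ^ r' = \<alpha> ^ n" by (simp_all add: s r_def r'_def)
  then have "\<gamma> = \<alpha> powi (int r - int r')"
    using m \<open>\<alpha> \<noteq> 0\<close> by (simp add: power_int_diff field_simps)
  moreover have "\<alpha> powi int s = 1" using s[of s 0] by simp
  ultimately show ?thesis using that by blast
qed

text \<open>Replacing \<open>x\<close> by \<open>\<alpha> * x\<close> fixes \<open>x powi s\<close>
  and multiplies \<open>x powi e\<close> by \<open>\<alpha> powi e\<close>.\<close>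

lemma power_form_scaling:
  fixes \<psi> :: "'a::field poly fract"
  assumes "\<alpha> \<noteq> 0" "\<alpha> powi s = 1"
  shows "rf_X powi e * (\<psi> \<circ>\<^sub>R (rf_X powi s)) \<circ>\<^sub>R (rf_const \<alpha> * rf_X)
    = rf_const (\<alpha> powi e) * (rf_X powi e * (\<psi> \<circ>\<^sub>R (rf_X powi s)))"
proof -
  note G = rf_scaling_nonconst[OF \<open>\<alpha> \<noteq> 0\<close>]
  have "rf_const \<alpha> powi s = 1" using assms(2) by (metis rf_const_1 rf_const_power_int)
  then show ?thesis
    by (simp add: rf_comp_hom[OF G] rf_comp_assoc[OF G] power_int_mult_distrib mult.assoc)
qed

subsection \<open>Classification\<close>

theorem theorem1p2:
  fixes p :: nat and f g h :: "'a::field poly fract"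
  assumes "p = CHAR('a)"
    and "rf_degree g = 1" and "rf_degree h = 1"
    and "\<exists>\<rho>. rf_eval g \<rho> = \<rho>" and "\<exists>\<rho>. rf_eval h \<rho> = \<rho>"
    and "f \<notin> range rf_const"
  shows "f \<circ>\<^sub>R g = h \<circ>\<^sub>R f \<longleftrightarrow>
    (\<exists>u v \<psi>. rf_degree u = 1 \<and> rf_degree v = 1 \<and>
      ((\<exists>\<delta>.
          f = rf_inv u \<circ>\<^sub>R (rf_const \<delta> * rf_X + (\<psi> \<circ>\<^sub>R (rf_X ^ p - rf_X))) \<circ>\<^sub>R rf_inv v \<and>
          g = v \<circ>\<^sub>R (rf_inv v + 1) \<and>
          h = rf_inv u \<circ>\<^sub>R (u + rf_const \<delta>) \<and>
          (p = 0 \<longrightarrow> \<psi> \<in> range rf_const)) \<or>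
       (\<exists>(e::int) (s::int) \<alpha>.
          f = rf_inv u \<circ>\<^sub>R (rf_X powi e * (\<psi> \<circ>\<^sub>R (rf_X powi s))) \<circ>\<^sub>R rf_inv v \<and>
          g = v \<circ>\<^sub>R (rf_const \<alpha> * rf_inv v) \<and>
          h = rf_inv u \<circ>\<^sub>R (rf_const (\<alpha> powi e) * u) \<and>
          \<alpha> \<noteq> 0 \<and> \<alpha> powi s = 1)))"
    (is "_ \<longleftrightarrow> (\<exists>u v \<psi>. rf_degree u = 1 \<and> rf_degree v = 1 \<and> (?translation u v \<psi> \<or> ?scaling u v \<psi>))")
proof
  note hn = rf_degree_1_nonconst[OF \<open>rf_degree h = 1\<close>]
  have comp1: "(rf_X + 1) \<circ>\<^sub>R w = w + 1" if "rf_degree w = 1" for w :: "'a poly fract"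
    using rf_comp_add[OF rf_degree_1_nonconst[OF that]] by simp
  have compc: "(rf_X + rf_const c) \<circ>\<^sub>R w = w + rf_const c" if "w \<notin> range rf_const" for w :: "'a poly fract" and c
    using rf_comp_add[OF that] by simp
  have compm: "(rf_const c * rf_X) \<circ>\<^sub>R w = rf_const c * w" if "w \<notin> range rf_const" for w :: "'a poly fract" and c
    using rf_comp_mult[OF that] by simp
  {
    assume fg: "f \<circ>\<^sub>R g = h \<circ>\<^sub>R f"
    obtain \<rho> \<sigma> where \<rho>: "rf_eval g \<rho> = \<rho>" and \<sigma>: "rf_eval h \<sigma> = \<sigma>" using assms(4,5) by blast
    \<comment> \<open>Stated for arbitrary \<open>\<delta>\<close> because it is used twice: with 1
      when \<open>h\<close> is a genuine translation, and with 0 when \<open>h\<close> is a scaling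
      forced to be the identity.\<close>
    have translation_case: "\<exists>u v \<psi>. rf_degree u = 1 \<and> rf_degree v = 1 \<and> ?translation u v \<psi>"
      if w: "rf_degree w = 1" "w \<circ>\<^sub>R g = w + 1" and u: "rf_degree u = 1" "u \<circ>\<^sub>R h = u + rf_const \<delta>"
      for w u \<delta>
    proof -
      note un = rf_degree_1_nonconst[OF u(1)]
      obtain F where F: "F \<notin> range rf_const" "F \<circ>\<^sub>R (rf_X + 1) = (rf_X + rf_const \<delta>) \<circ>\<^sub>R F"
        and fF: "f = rf_inv u \<circ>\<^sub>R F \<circ>\<^sub>R rf_inv (rf_inv w)"
        and gw: "g = rf_inv w \<circ>\<^sub>R ((rf_X + 1) \<circ>\<^sub>R rf_inv (rf_inv w))"
        and hu: "h = rf_inv u \<circ>\<^sub>R ((rf_X + rf_const \<delta>) \<circ>\<^sub>R u)"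
        by (rule conjugate_commuteD[OF u(1) w(1) assms(2) _ _ assms(6) hn rf_X_plus_1_nonconst fg,
              where H = "rf_X + rf_const \<delta>"]) (use w u un in \<open>simp_all add: comp1 compc\<close>)
      have "F \<circ>\<^sub>R (rf_X + 1) = F + rf_const \<delta>" using F by (simp add: compc)
      from shift_equivariant[OF this assms(1)] obtain \<psi> where
        \<psi>: "F = rf_const \<delta> * rf_X + (\<psi> \<circ>\<^sub>R (rf_X ^ p - rf_X))" "p = 0 \<longrightarrow> \<psi> \<in> range rf_const" .
      have "rf_degree u = 1 \<and> rf_degree (rf_inv w) = 1 \<and> ?translation u (rf_inv w) \<psi>"
        using u w fF gw hu \<psi> rf_inv[OF w(1)] un by (auto simp: rf_inv_rf_inv comp1 compc)
      then show ?thesis by blast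
    qed
    show "\<exists>u v \<psi>. rf_degree u = 1 \<and> rf_degree v = 1 \<and> (?translation u v \<psi> \<or> ?scaling u v \<psi>)"
    proof (cases rule: fixed_point_normal_form[OF assms(2) \<rho>])
      case (1 w)
      note w = 1
      show ?thesis
      proof (cases rule: fixed_point_normal_form[OF assms(3) \<sigma>])
        case (1 u)
        then show ?thesis using translation_case[OF w, of u 1] by simp blast
      next
        case (2 u \<gamma>)
        note un = rf_degree_1_nonconst[OF 2(1)]
        obtain F where F: "F \<notin> range rf_const" "F \<circ>\<^sub>R (rf_X + 1) = (rf_const \<gamma> * rf_X) \<circ>\<^sub>R F"
          by (rule conjugate_commuteD[OF 2(1) w(1) assms(2) _ _ assms(6) hn rf_X_plus_1_nonconst fg,
                where H = "rf_const \<gamma> * rf_X"]) (use w 2 un in \<open>simp_all add: comp1 compm\<close>)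
        have "F \<noteq> 0" using F(1) rf_const_0 by (metis rangeI)
        \<comment> \<open>A nonzero eigenfunction of the shift has eigenvalue 1, so \<open>u\<close>
          is unchanged by \<open>h\<close> and the translation form applies with
          \<open>\<delta> = 0\<close>.\<close>
        then have "\<gamma> = 1" using F 2(2) by (intro shift_eigenvalue[of F]) (simp_all add: compm)
        then show ?thesis using translation_case[OF w 2(1), of 0] 2(3) by simp blast
      qed
    next
      case (2 w \<alpha>)
      note w = 2 and wn = rf_degree_1_nonconst[OF 2(1)] and G = rf_scaling_nonconst[OF 2(2)]
      show ?thesis
      proof (cases rule: fixed_point_normal_form[OF assms(3) \<sigma>])
        case (1 u)
        obtain F where F: "F \<notin> range rf_const" "F \<circ>\<^sub>R (rf_const \<alpha> * rf_X) = (rf_X + 1) \<circ>\<^sub>R F"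
          by (rule conjugate_commuteD[OF 1(1) w(1) assms(2) _ _ assms(6) hn G fg, where H = "rf_X + 1"])
            (use w 1 wn in \<open>simp_all add: comp1 compm\<close>)
        \<comment> \<open>This combination is contradictory: no \<open>F\<close> turns a scaling
          into the unit translation.\<close>
        then show ?thesis using scaling_not_translation[OF w(2), of F] compc[of F 1] by simp
      next
        case (2 u \<gamma>)
        note un = rf_degree_1_nonconst[OF 2(1)]
        obtain F where F: "F \<notin> range rf_const" "F \<circ>\<^sub>R (rf_const \<alpha> * rf_X) = (rf_const \<gamma> * rf_X) \<circ>\<^sub>R F"
          and fF: "f = rf_inv u \<circ>\<^sub>R F \<circ>\<^sub>R rf_inv (rf_inv w)"
          and gw: "g = rf_inv w \<circ>\<^sub>R ((rf_const \<alpha> * rf_X) \<circ>\<^sub>R rf_inv (rf_inv w))"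
          and hu: "h = rf_inv u \<circ>\<^sub>R ((rf_const \<gamma> * rf_X) \<circ>\<^sub>R u)"
          by (rule conjugate_commuteD[OF 2(1) w(1) assms(2) _ _ assms(6) hn G fg, where H = "rf_const \<gamma> * rf_X"])
            (use w 2 wn un in \<open>simp_all add: compm\<close>)
        have "F \<noteq> 0" using F(1) rf_const_0 by (metis rangeI)
        moreover have "F \<circ>\<^sub>R (rf_const \<alpha> * rf_X) = rf_const \<gamma> * F" using F by (simp add: compm)
        ultimately obtain e s :: int and \<psi> where
          \<psi>: "F = rf_X powi e * (\<psi> \<circ>\<^sub>R (rf_X powi s))" "\<gamma> = \<alpha> powi e" "\<alpha> powi s = 1"
          using scaling_equivariant[OF _ _ w(2) 2(2)] by metis
        have "rf_degree u = 1 \<and> rf_degree (rf_inv w) = 1" using 2(1) rf_inv[OF w(1)] by simp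
        moreover have "?scaling u (rf_inv w) \<psi>"
          using fF gw hu w(2) wn un unfolding rf_inv_rf_inv[OF w(1)] compm[OF wn] compm[OF un] \<psi>(1,2)
          using \<psi>(3) by blast
        ultimately show ?thesis by blast
      qed
    qed
  }
  \<comment> \<open>Conversely, each normal form satisfies its equivariance equation, and
    conjugating by \<open>u\<close> and \<open>v\<close> carries the equation over to
    \<open>f\<close>, \<open>g\<close> and \<open>h\<close>.\<close>
  assume "\<exists>u v \<psi>. rf_degree u = 1 \<and> rf_degree v = 1 \<and> (?translation u v \<psi> \<or> ?scaling u v \<psi>)"
  then obtain u v \<psi> where uv: "rf_degree u = 1" "rf_degree v = 1"
    and cases: "?translation u v \<psi> \<or> ?scaling u v \<psi>" by blast
  note un = rf_degree_1_nonconst[OF uv(1)] and ivn = rf_degree_1_nonconst[OF rf_inv(1)[OF uv(2)]]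
  have nonconst: "F \<notin> range rf_const" if "f = rf_inv u \<circ>\<^sub>R F \<circ>\<^sub>R rf_inv v" for F
    using rf_comp_nonconstD assms(6) that by blast
  from cases show "f \<circ>\<^sub>R g = h \<circ>\<^sub>R f"
  proof
    assume "?translation u v \<psi>"
    then obtain \<delta> where
      f: "f = rf_inv u \<circ>\<^sub>R (rf_const \<delta> * rf_X + (\<psi> \<circ>\<^sub>R (rf_X ^ p - rf_X))) \<circ>\<^sub>R rf_inv v"
      and g: "g = v \<circ>\<^sub>R (rf_inv v + 1)" and h: "h = rf_inv u \<circ>\<^sub>R (u + rf_const \<delta>)"
      and \<psi>: "p = 0 \<longrightarrow> \<psi> \<in> range rf_const" by blast
    show ?thesis
      by (rule conjugate_commute[OF uv f _ _ assms(6) rf_X_plus_1_nonconst, where H = "rf_X + rf_const \<delta>"])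
        (use g h in \<open>simp_all add: comp1 rf_inv(1)[OF uv(2)] compc un nonconst[OF f]
          artin_schreier_shift[OF assms(1) \<psi>]\<close>)
  next
    assume "?scaling u v \<psi>"
    then obtain e s :: int and \<alpha> where
      f: "f = rf_inv u \<circ>\<^sub>R (rf_X powi e * (\<psi> \<circ>\<^sub>R (rf_X powi s))) \<circ>\<^sub>R rf_inv v"
      and g: "g = v \<circ>\<^sub>R (rf_const \<alpha> * rf_inv v)" and h: "h = rf_inv u \<circ>\<^sub>R (rf_const (\<alpha> powi e) * u)"
      and \<alpha>: "\<alpha> \<noteq> 0" "\<alpha> powi s = 1" by blast
    show ?thesis
      by (rule conjugate_commute[OF uv f _ _ assms(6) rf_scaling_nonconst[OF \<alpha>(1)],
            where H = "rf_const (\<alpha> powi e) * rf_X"])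
        (use g h in \<open>simp_all add: compm un ivn nonconst[OF f] power_form_scaling[OF \<alpha>] del: rf_const_power_int\<close>)
  qed
qed

end
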